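(* Let $N\ge 1$, $K\in\{1,\dots,N\}$, let $\mathbb M_4$ be any one of the real spaces $\mathbb E^4,\mathbb M^{3,1},\mathbb U^{2,2}_1,\mathbb U^{2,2}_2$, and let $J_{[N]}$ be the quasi-Grammian $N$-soliton ansatz on $\mathbb M_4$ (defined in the context). Fix a value $l_K$ of $L_K$ and a choice of signs $(\varepsilon_j^+,\varepsilon_j^-)\in\{(+,-),(-,+)\}$ for $j\neq K$. Then, in the asymptotic region determined by $L_K=l_K$ and these signs, $J_{[N]}$ converges to $$\mathcal J^{(K)}_{[N]}=\frac{\begin{pmatrix}\widetilde\gamma_{KK}\,p_K\widetilde p_K|E_K^{(+)}|^2+\gamma_{KK}\,q_K\widetilde q_K|E_K^{(-)}|^2 & -p_K\widetilde q_K\,E_K^{(+)}\overline{E}_K^{(-)}\\ -\widetilde p_K q_K\,\overline{E}_K^{(+)}E_K^{(-)} & \gamma_{KK}\,p_K\widetilde p_K|E_K^{(+)}|^2+\widetilde\gamma_{KK}\,q_K\widetilde q_K|E_K^{(-)}|^2\end{pmatrix}}{\gamma_{KK}\left(p_K\widetilde p_K|E_K^{(+)}|^2+q_K\widetilde q_K|E_K^{(-)}|^2\right)}\;C^{(K)},$$ where $$p_K=\prod_{j\ne K}(\lambda_K^{(+)}-\lambda_j^{(\varepsilon_j^+)}),\quad \widetilde p_K=\prod_{j\ne K}(\lambda_K^{(-)}-\lambda_j^{(\varepsilon_j^-)}),\quad q_K=\prod_{j\ne K}(\lambda_K^{(+)}-\lambda_j^{(\varepsilon_j^-)}),\quad \widetilde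 q_K=\prod_{j\ne K}(\lambda_K^{(-)}-\lambda_j^{(\varepsilon_j^+)}),$$ (products over $1\le j\le N$, $j\neq K$), and $C^{(K)}$ is the constant matrix $$C^{(K)}=\mathrm{diag}\Big(\prod_{j\ne K}c_j(\varepsilon_j^+),\ \prod_{j\neq K}c_j(\varepsilon_j^-)\Big),\qquad c_j(+):=\lambda_j^{(+)}/\lambda_j^{(-)},\quad c_j(-):=1.$$
   Context: Coordinates and real spaces. Coordinates $(z^1,z^2,z^3,z^4)=(z,\widetilde z,w,\widetilde w)$ on complex four-space are restricted to a real space by: $\mathbb E^4$: $\widetilde z=\bar z,\ \widetilde w=-\bar w$; $\mathbb M^{3,1}$: $z,\widetilde z\in\mathbb R,\ \widetilde w=\bar w$; $\mathbb U_1^{2,2}$: $z,\widetilde z,w,\widetilde w\in\mathbb R$; $\mathbb U_2^{2,2}$: $\widetilde z=\bar z,\ \widetilde w=\bar w$. Ansatz. For complex parameters $a_j^{(\pm)},\alpha_j,\beta_j,\lambda_j$ ($1\le j\le N$) put $$L_j=\lambda_j\alpha_j z+\beta_j\widetilde z+\lambda_j\beta_j w+\alpha_j\widetilde w,\qquad E_j^{(\pm)}=(a_j^{(\pm)})^2e^{\pm L_j}.$$ The parameters $\mu_j,\widetilde\alpha_j,\widetilde\beta_j$ are determined by the real space: (1) $\mathbb U_1^{2,2}$: $\mu_j=\bar\lambda_j,\ \widetilde\alpha_j=\bar\alpha_j,\ \widetilde\beta_j=\bar\beta_j$; (2) $\mathbb M^{3,1}$: the same together with the constraint $\alpha_j=\lambda_j\beta_j$;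 (3) $\mathbb E^4$: $\mu_j=-1/\bar\lambda_j,\ \widetilde\alpha_j=-\bar\lambda_j\bar\beta_j,\ \widetilde\beta_j=\bar\lambda_j\bar\alpha_j$; (4) $\mathbb U_2^{2,2}$: $\mu_j=1/\bar\lambda_j,\ \widetilde\alpha_j=\bar\lambda_j\bar\beta_j,\ \widetilde\beta_j=\bar\lambda_j\bar\alpha_j$. With these choices $\widetilde L_j:=\mu_j\widetilde\alpha_jz+\widetilde\beta_j\widetilde z+\mu_j\widetilde\beta_jw+\widetilde\alpha_j\widetilde w$ equals $\overline{L_j}$ on the real space. Set $$\theta=\begin{pmatrix} E_1^{(+)} & \cdots & E_N^{(+)} \\ E_1^{(-)} & \cdots & E_N^{(-)} \end{pmatrix},\quad \Xi=\mathrm{diag}(\mu_1,\dots,\mu_N),\quad \gamma_{jk}=\frac{\mu_j}{\mu_j-\lambda_k},\quad \widetilde\gamma_{jk}=\frac{\lambda_j}{\mu_k-\lambda_j},$$ and let $\Omega$ be the $N\times N$ matrix with $\Omega_{jk}=(\theta^\dagger\theta)_{jk}/(\mu_j-\lambda_k)$, so that $(\Xi^T\Omega)_{jk}=\gamma_{jk}(\overline{E}_j^{(+)}E_k^{(+)}+\overline{E}_j^{(-)}E_k^{(-)})$. The quasi-Grammian $N$-soliton ansatz is the $2\times2$ matrix (a quasideterminant with boxed block $I=I_2$) $$J_{[N]}=\begin{vmatrix} \Xi^T\Omega & \theta^\dagger \\ \theta & \boxed{I} \end{vmatrix}:=I-\theta\,(\Xi^T\Omega)^{-1}\theta^\dagger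 .$$ Genericity. Assume $\lambda_j\ne0$, $a_j^{(\pm)}\neq0$, the $\lambda_j$ are pairwise distinct, $\mu_j\neq\lambda_k$ for all $j,k$, and the denominator $p_K\widetilde p_K|E_K^{(+)}|^2+q_K\widetilde q_K|E_K^{(-)}|^2$ is nonzero at $L_K=l_K$. Notation. $\lambda_j^{(+)}:=\lambda_j$, $\lambda_j^{(-)}:=\mu_j$. Asymptotic region. For $M>0$ the region consists of all points of $\mathbb M_4$ with $L_K=l_K$ and, for each $j\ne K$, $\mathrm{Re}(L_j)>M$ if $(\varepsilon_j^+,\varepsilon_j^-)=(+,-)$ and $\mathrm{Re}(L_j)<-M$ if $(\varepsilon_j^+,\varepsilon_j^-)=(-,+)$. Convergence in the asymptotic region (written $r\to\infty$, $r$ the Euclidean distance to the origin) means: for every $\eta>0$ there is $M>0$ such that at every point of the region with parameter $M$ the quantity differs from its limit by less than $\eta$. Note that $E_K^{(\pm)}$ takes the fixed value determined by $l_K$ there. *)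

theory Defs
  imports "HOL-Analysis.Analysis"
begin

datatype real_space = E4 | M31 | U22_1 | U22_2

text \<open>A point of complex four-space has the components
  \<open>x $ 1, x $ 2, x $ 3, x $ 4\<close>, i.e. the coordinates
  \<open>z\<close>, \<open>z~\<close>, \<open>w\<close>, \<open>w~\<close> in this order.\<close>

fun points :: "real_space \<Rightarrow> (complex ^ 4) set" where
  "points E4 = {x. x $ 2 = cnj (x $ 1) \<and> x $ 4 = - cnj (x $ 3)}"
| "points M31 = {x. x $ 1 \<in> \<real> \<and> x $ 2 \<in> \<real> \<and> x $ 4 = cnj (x $ 3)}"
| "points U22_1 = {x. x $ 1 \<in> \<real> \<and> x $ 2 \<in> \<real> \<and> x $ 3 \<in> \<real> \<and> x $ 4 \<in> \<real>}"
| "points U22_2 = {x. x $ 2 = cnj (x $ 1) \<and> x $ 4 = cnj (x $ 3)}"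

definition phase :: "complex \<Rightarrow> complex \<Rightarrow> complex \<Rightarrow> complex ^ 4 \<Rightarrow> complex" where
  "phase l a b x = l * a * (x $ 1) + b * (x $ 2) + l * b * (x $ 3) + a * (x $ 4)"

fun mu_of :: "real_space \<Rightarrow> complex \<Rightarrow> complex" where
  "mu_of E4 l = - 1 / cnj l"
| "mu_of M31 l = cnj l"
| "mu_of U22_1 l = cnj l"
| "mu_of U22_2 l = 1 / cnj l"

text \<open>The tilded parameters enter only through the conjugate phase, see
  \<open>phase_conj\<close> below; the ansatz itself uses conjugate transposes.\<close>

fun alpha_tilde :: "real_space \<Rightarrow> complex \<Rightarrow> complex \<Rightarrow> complex \<Rightarrow> complex" where
  "alpha_tilde E4 l a b = - cnj l * cnj b"
| "alpha_tilde M31 l a b = cnj a"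
| "alpha_tilde U22_1 l a b = cnj a"
| "alpha_tilde U22_2 l a b = cnj l * cnj b"

fun beta_tilde :: "real_space \<Rightarrow> complex \<Rightarrow> complex \<Rightarrow> complex \<Rightarrow> complex" where
  "beta_tilde E4 l a b = cnj l * cnj a"
| "beta_tilde M31 l a b = cnj b"
| "beta_tilde U22_1 l a b = cnj b"
| "beta_tilde U22_2 l a b = cnj l * cnj a"

lemma phase_conj:
  assumes "x \<in> points R" and "l \<noteq> 0" and "R = M31 \<Longrightarrow> a = l * b"
  shows "phase (mu_of R l) (alpha_tilde R l a b) (beta_tilde R l a b) x = cnj (phase l a b x)"
proof (cases R)
  case M31
  then show ?thesis
    using assms by (auto simp: phase_def algebra_simps Reals_cnj_iff)
qed (use assms in \<open>auto simp: phase_def field_simps Reals_cnj_iff\<close>)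

datatype pm = Plus | Minus

fun pm_sgn :: "pm \<Rightarrow> complex" where
  "pm_sgn Plus = 1"
| "pm_sgn Minus = - 1"

text \<open>\<open>amp a s l\<close> is the exponential \<open>E\<close> with sign \<open>s\<close> at phase value \<open>l\<close>.\<close>

definition amp :: "(pm \<Rightarrow> complex) \<Rightarrow> pm \<Rightarrow> complex \<Rightarrow> complex" where
  "amp a s l = (a s)\<^sup>2 * exp (pm_sgn s * l)"

definition ctranspose :: "complex ^ 'n ^ 'm \<Rightarrow> complex ^ 'm ^ 'n" where
  "ctranspose A = (\<chi> i j. cnj (A $ j $ i))"

text \<open>The quasideterminant of the block matrix with rows \<open>(A, B)\<close> and \<open>(C, D)\<close>, the block
  \<open>D\<close> being boxed. It is meaningful only for invertible \<open>A\<close>; \<open>matrix_inv\<close> is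
  unspecified otherwise.\<close>

definition quasidet ::
  "'a::comm_ring_1 ^ 'n ^ 'n \<Rightarrow> 'a ^ 'm ^ 'n \<Rightarrow> 'a ^ 'n ^ 'm \<Rightarrow> 'a ^ 'm ^ 'm \<Rightarrow> 'a ^ 'm ^ 'm" where
  "quasidet A B C D = D - C ** matrix_inv A ** B"

text \<open>From here on solitons are indexed by a finite type \<open>'n\<close>, so that \<open>N\<close> is
  \<open>CARD('n)\<close>. The argument \<open>L\<close> collects the values of all phases at a point.\<close>

definition theta_mat :: "('n \<Rightarrow> pm \<Rightarrow> complex) \<Rightarrow> ('n \<Rightarrow> complex) \<Rightarrow> complex ^ 'n ^ 2" where
  "theta_mat a L = (\<chi> i j. amp (a j) (if i = 1 then Plus else Minus) (L j))"

definition Xi_mat :: "('n \<Rightarrow> complex) \<Rightarrow> complex ^ 'n ^ 'n" where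
  "Xi_mat \<mu> = (\<chi> j k. if j = k then \<mu> j else 0)"

definition Omega_mat ::
  "('n \<Rightarrow> complex) \<Rightarrow> ('n \<Rightarrow> complex) \<Rightarrow> complex ^ 'n ^ 2 \<Rightarrow> complex ^ 'n ^ 'n" where
  "Omega_mat lam \<mu> \<theta> = (\<chi> j k. (ctranspose \<theta> ** \<theta>) $ j $ k / (\<mu> j - lam k))"

definition XiOmega ::
  "('n::finite \<Rightarrow> complex) \<Rightarrow> ('n \<Rightarrow> complex) \<Rightarrow> ('n \<Rightarrow> pm \<Rightarrow> complex) \<Rightarrow> ('n \<Rightarrow> complex) \<Rightarrow> complex ^ 'n ^ 'n" where
  "XiOmega lam \<mu> a L = transpose (Xi_mat \<mu>) ** Omega_mat lam \<mu> (theta_mat a L)"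

definition J_ansatz ::
  "('n::finite \<Rightarrow> complex) \<Rightarrow> ('n \<Rightarrow> complex) \<Rightarrow> ('n \<Rightarrow> pm \<Rightarrow> complex) \<Rightarrow> ('n \<Rightarrow> complex) \<Rightarrow> complex ^ 2 ^ 2" where
  "J_ansatz lam \<mu> a L =
     quasidet (XiOmega lam \<mu> a L) (ctranspose (theta_mat a L)) (theta_mat a L) (mat 1)"

definition gamma_coef :: "('n \<Rightarrow> complex) \<Rightarrow> ('n \<Rightarrow> complex) \<Rightarrow> 'n \<Rightarrow> 'n \<Rightarrow> complex" where
  "gamma_coef lam \<mu> j k = \<mu> j / (\<mu> j - lam k)"

definition gamma_tilde :: "('n \<Rightarrow> complex) \<Rightarrow> ('n \<Rightarrow> complex) \<Rightarrow> 'n \<Rightarrow> 'n \<Rightarrow> complex" where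
  "gamma_tilde lam \<mu> j k = lam j / (\<mu> k - lam j)"

fun lambda_pm :: "('n \<Rightarrow> complex) \<Rightarrow> ('n \<Rightarrow> complex) \<Rightarrow> pm \<Rightarrow> 'n \<Rightarrow> complex" where
  "lambda_pm lam \<mu> Plus j = lam j"
| "lambda_pm lam \<mu> Minus j = \<mu> j"

definition shift_prod ::
  "('n::finite \<Rightarrow> complex) \<Rightarrow> ('n \<Rightarrow> complex) \<Rightarrow> 'n \<Rightarrow> pm \<Rightarrow> ('n \<Rightarrow> pm) \<Rightarrow> complex" where
  "shift_prod lam \<mu> K s \<epsilon> = (\<Prod>j\<in>UNIV - {K}. lambda_pm lam \<mu> s K - lambda_pm lam \<mu> (\<epsilon> j) j)"

fun c_coef :: "('n \<Rightarrow> complex) \<Rightarrow> ('n \<Rightarrow> complex) \<Rightarrow> 'n \<Rightarrow> pm \<Rightarrow> complex" where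
  "c_coef lam \<mu> j Plus = lambda_pm lam \<mu> Plus j / lambda_pm lam \<mu> Minus j"
| "c_coef lam \<mu> j Minus = 1"

definition C_mat ::
  "('n::finite \<Rightarrow> complex) \<Rightarrow> ('n \<Rightarrow> complex) \<Rightarrow> 'n \<Rightarrow> ('n \<Rightarrow> pm) \<Rightarrow> ('n \<Rightarrow> pm) \<Rightarrow> complex ^ 2 ^ 2" where
  "C_mat lam \<mu> K \<epsilon>p \<epsilon>m = vector
     [vector [\<Prod>j\<in>UNIV - {K}. c_coef lam \<mu> j (\<epsilon>p j), 0],
      vector [0, \<Prod>j\<in>UNIV - {K}. c_coef lam \<mu> j (\<epsilon>m j)]]"

text \<open>Here \<open>Ep\<close>, \<open>Em\<close> are the two exponentials of the \<open>K\<close>-th soliton.\<close>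

definition J_denom ::
  "('n::finite \<Rightarrow> complex) \<Rightarrow> ('n \<Rightarrow> complex) \<Rightarrow> 'n \<Rightarrow> ('n \<Rightarrow> pm) \<Rightarrow> ('n \<Rightarrow> pm) \<Rightarrow> complex \<Rightarrow> complex \<Rightarrow> complex" where
  "J_denom lam \<mu> K \<epsilon>p \<epsilon>m Ep Em =
    (let p = shift_prod lam \<mu> K Plus \<epsilon>p; p' = shift_prod lam \<mu> K Minus \<epsilon>m;
         q = shift_prod lam \<mu> K Plus \<epsilon>m; q' = shift_prod lam \<mu> K Minus \<epsilon>p
     in p * p' * of_real ((cmod Ep)\<^sup>2) + q * q' * of_real ((cmod Em)\<^sup>2))"

definition J_limit ::
  "('n::finite \<Rightarrow> complex) \<Rightarrow> ('n \<Rightarrow> complex) \<Rightarrow> 'n \<Rightarrow> ('n \<Rightarrow> pm) \<Rightarrow> ('n \<Rightarrow> pm) \<Rightarrow> complex \<Rightarrow> complex \<Rightarrow> complex ^ 2 ^ 2" where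
  "J_limit lam \<mu> K \<epsilon>p \<epsilon>m Ep Em =
    (let p = shift_prod lam \<mu> K Plus \<epsilon>p; p' = shift_prod lam \<mu> K Minus \<epsilon>m;
         q = shift_prod lam \<mu> K Plus \<epsilon>m; q' = shift_prod lam \<mu> K Minus \<epsilon>p;
         g = gamma_coef lam \<mu> K K; g' = gamma_tilde lam \<mu> K K;
         A = of_real ((cmod Ep)\<^sup>2); B = of_real ((cmod Em)\<^sup>2)
     in map_matrix (\<lambda>e. e / (g * J_denom lam \<mu> K \<epsilon>p \<epsilon>m Ep Em))
          (vector
            [vector [g' * p * p' * A + g * q * q' * B, - p * q' * Ep * cnj Em],
             vector [- p' * q * cnj Ep * Em, g * p * p' * A + g' * q * q' * B]])
        ** C_mat lam \<mu> K \<epsilon>p \<epsilon>m)"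

definition asymp_region ::
  "real_space \<Rightarrow> ('n \<Rightarrow> complex ^ 4 \<Rightarrow> complex) \<Rightarrow> 'n \<Rightarrow> complex \<Rightarrow> ('n \<Rightarrow> pm) \<Rightarrow> ('n \<Rightarrow> pm) \<Rightarrow> real
    \<Rightarrow> (complex ^ 4) set" where
  "asymp_region R L K l \<epsilon>p \<epsilon>m M = {x \<in> points R. L K x = l \<and>
     (\<forall>j. j \<noteq> K \<longrightarrow>
        ((\<epsilon>p j, \<epsilon>m j) = (Plus, Minus) \<longrightarrow> Re (L j x) > M) \<and>
        ((\<epsilon>p j, \<epsilon>m j) = (Minus, Plus) \<longrightarrow> Re (L j x) < - M))}"

end

theory Submission
  imports Defs
begin

text \<open>Rescaling the columns of \<open>\<theta>\<close> does not change \<open>J\<close>. Dividing the column of each soliton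
  \<open>j \<noteq> K\<close> by its dominant exponential makes \<open>\<theta>\<close> converge to a matrix \<open>V\<close> whose columns
  \<open>v\<^sub>j\<close> are unit vectors for \<open>j \<noteq> K\<close>, so it suffices to invert the limiting Gram matrix and to
  compute \<open>J\<close> there. If \<open>X\<close> solves the linear system with right-hand side \<open>V\<^sup>\<dagger> b\<close>, then
  \<open>\<Phi>(\<zeta>) = b - \<Sum>\<^sub>k X\<^sub>k v\<^sub>k \<zeta> / (\<zeta> - \<lambda>\<^sub>k)\<close> is orthogonal to \<open>v\<^sub>j\<close> at \<open>\<zeta> = \<mu>\<^sub>j\<close>, and
  \<open>\<Phi>(\<infinity>) = J b\<close>. For \<open>j \<noteq> K\<close> this prescribes zeros of the two scalar components of \<open>\<Phi>\<close>, which
  determine them up to \<open>X\<^sub>K\<close>; orthogonality to \<open>v\<^sub>K\<close> at \<open>\<mu>\<^sub>K\<close> is then one linear equation for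
  \<open>X\<^sub>K\<close>, whose coefficient is proportional to the denominator of the limit.\<close>

subsection \<open>Rational functions with prescribed zeros and poles\<close>

text \<open>Both sides are polynomials in \<open>z\<close> of degree at most
  \<open>card S + 1\<close>, so agreement at \<open>card S + 2\<close> distinct points suffices. At
  \<open>0\<close> the factors \<open>lam j / \<mu> j\<close> balance, at \<open>lam K\<close> only
  the summand \<open>k = K\<close> survives, and at each \<open>\<mu> j\<close> both sides vanish.
  Being free of denominators, the identity can also be evaluated at the poles
  \<open>lam k\<close>.\<close>

lemma interpolation_polynomial:
  fixes lam \<mu> x :: "'a \<Rightarrow> 'b::field"
  assumes "finite S" and "K \<notin> S"
    and mu_lam: "\<And>j k. j \<in> insert K S \<Longrightarrow> k \<in> insert K S \<Longrightarrow> \<mu> j \<noteq> lam k"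
    and lam_nz: "\<And>k. k \<in> insert K S \<Longrightarrow> lam k \<noteq> 0"
    and mu_nz: "\<And>j. j \<in> insert K S \<Longrightarrow> \<mu> j \<noteq> 0"
    and inj_mu: "inj_on \<mu> S"
    and zeros: "\<And>j. j \<in> S \<Longrightarrow> c - (\<Sum>k\<in>insert K S. x k * (\<mu> j / (\<mu> j - lam k))) = 0"
  shows "c * (\<Prod>k\<in>insert K S. z - lam k)
           - z * (\<Sum>k\<in>insert K S. x k * (\<Prod>i\<in>insert K S - {k}. z - lam i))
       = (\<Prod>j\<in>S. lam j / \<mu> j * (z - \<mu> j))
           * (c * (z - lam K)
              - x K * (\<Prod>j\<in>S. \<mu> j / lam j * ((lam K - lam j) / (lam K - \<mu> j))) * z)"
proof -
  let ?T = "insert K S"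
  let ?\<rho> = "\<Prod>j\<in>S. \<mu> j / lam j * ((lam K - lam j) / (lam K - \<mu> j))"
  define p where "p = smult c (\<Prod>k\<in>?T. [:- lam k, 1:])
      - [:0, 1:] * (\<Sum>k\<in>?T. smult (x k) (\<Prod>i\<in>?T - {k}. [:- lam i, 1:]))"
  define q where "q = (\<Prod>j\<in>S. smult (lam j / \<mu> j) [:- \<mu> j, 1:])
      * (smult c [:- lam K, 1:] - smult (x K * ?\<rho>) [:0, 1:])"
  have poly_p: "poly p z = c * (\<Prod>k\<in>?T. z - lam k)
      - z * (\<Sum>k\<in>?T. x k * (\<Prod>i\<in>?T - {k}. z - lam i))" for z
    by (simp add: p_def poly_prod poly_sum algebra_simps)
  have poly_q: "poly q z = (\<Prod>j\<in>S. lam j / \<mu> j * (z - \<mu> j))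
      * (c * (z - lam K) - x K * ?\<rho> * z)" for z
    unfolding q_def poly_mult poly_prod
    by (intro arg_cong2[of _ _ _ _ times] prod.cong) (auto simp: field_simps)
  let ?A = "insert 0 (insert (lam K) (\<mu> ` S))"
  have degree_linear: "degree (\<Prod>i\<in>A. smult (u i) [:v i, 1:]) \<le> card A"
    if "finite A" for A and u v :: "'a \<Rightarrow> 'b"
    using degree_prod_sum_le[OF that, of "\<lambda>i. smult (u i) [:v i, 1:]"]
      sum_bounded_above[of A "\<lambda>i. degree (smult (u i) [:v i, 1:])" 1]
    by fastforce
  have card_T: "card ?T = Suc (card S)"
    using assms by simp
  have card_A: "card ?A = Suc (Suc (card S))"
  proof -
    have "lam K \<notin> \<mu> ` S" "0 \<notin> insert (lam K) (\<mu> ` S)"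
      using mu_lam[of _ K] mu_nz lam_nz[of K] by (auto simp: image_iff) metis+
    then show ?thesis using assms(1) inj_mu by (simp add: card_image)
  qed
  have deg_p: "degree p \<le> Suc (card S)"
    unfolding p_def
  proof (rule degree_diff_le)
    show "degree (smult c (\<Prod>k\<in>?T. [:- lam k, 1:])) \<le> Suc (card S)"
      using degree_linear[of ?T "\<lambda>_. 1" "\<lambda>k. - lam k"] degree_smult_le le_trans card_T assms(1)
      by fastforce
    have "degree (\<Sum>k\<in>?T. smult (x k) (\<Prod>i\<in>?T - {k}. [:- lam i, 1:])) \<le> card S"
    proof (rule degree_sum_le)
      fix k assume "k \<in> ?T"
      then have "card (?T - {k}) = card S"
        using assms card_T by (subst card_Diff_singleton) auto
      then show "degree (smult (x k) (\<Prod>i\<in>?T - {k}. [:- lam i, 1:])) \<le> card S"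
        using degree_linear[of "?T - {k}" "\<lambda>_. 1" "\<lambda>k. - lam k"] degree_smult_le le_trans assms(1)
        by fastforce
    qed (use assms in simp)
    then show "degree ([:0, 1:] * (\<Sum>k\<in>?T. smult (x k) (\<Prod>i\<in>?T - {k}. [:- lam i, 1:])))
        \<le> Suc (card S)"
      by (intro order.trans[OF degree_mult_le]) simp
  qed
  have deg_q: "degree q \<le> Suc (card S)"
    unfolding q_def
  proof (rule order.trans[OF degree_mult_le])
    have "degree (smult c [:- lam K, 1:] - smult (x K * ?\<rho>) [:0, 1:]) \<le> 1"
      by (intro degree_diff_le) auto
    then show "degree (\<Prod>j\<in>S. smult (lam j / \<mu> j) [:- \<mu> j, 1:])
        + degree (smult c [:- lam K, 1:] - smult (x K * ?\<rho>) [:0, 1:]) \<le> Suc (card S)"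
      using degree_linear[OF assms(1), of "\<lambda>j. lam j / \<mu> j" "\<lambda>j. - \<mu> j"] by linarith
  qed
  have "p = q"
  proof (rule poly_eqI_degree)
    fix w assume "w \<in> ?A"
    then consider "w = 0" | "w = lam K" | j where "j \<in> S" "w = \<mu> j" by auto
    then show "poly p w = poly q w"
    proof cases
      case 1
      have "(\<Prod>j\<in>S. lam j / \<mu> j * (0 - \<mu> j)) = (\<Prod>j\<in>S. 0 - lam j)"
        using mu_nz by (intro prod.cong) auto
      then show ?thesis
        using 1 assms(1,2) by (simp add: poly_p poly_q)
    next
      case 2
      have "(\<Sum>k\<in>?T. x k * (\<Prod>i\<in>?T - {k}. lam K - lam i)) = x K * (\<Prod>i\<in>S. lam K - lam i)"
      proof -
        have "(\<Sum>k\<in>S. x k * (\<Prod>i\<in>?T - {k}. lam K - lam i)) = 0"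
          using assms(1,2) by (intro sum.neutral) (auto intro!: prod_zero)
        moreover have "?T - {K} = S" using assms(2) by auto
        ultimately show ?thesis using assms(1,2) by simp
      qed
      moreover have "(\<Prod>j\<in>S. lam j / \<mu> j * (lam K - \<mu> j)) * ?\<rho> = (\<Prod>i\<in>S. lam K - lam i)"
        unfolding prod.distrib[symmetric]
      proof (rule prod.cong)
        fix j assume "j \<in> S"
        then have "\<mu> j \<noteq> 0" "lam j \<noteq> 0" "lam K - \<mu> j \<noteq> 0"
          using mu_nz lam_nz mu_lam[of j K] by auto
        then show "lam j / \<mu> j * (lam K - \<mu> j)
            * (\<mu> j / lam j * ((lam K - lam j) / (lam K - \<mu> j))) = lam K - lam j"
          by simp
      qed simp
      moreover have "(\<Prod>k\<in>?T. lam K - lam k) = 0"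
        using assms(1) by simp
      ultimately show ?thesis
        using 2 by (simp add: poly_p poly_q mult_ac)
    next
      \<comment> \<open>At \<open>\<mu> j\<close> no factor of the full product vanishes, so it can
        be pulled out; what remains is the expression that \<open>zeros\<close> makes zero.\<close>
      case 3
      have "(\<Prod>i\<in>?T - {k}. w - lam i) = (\<Prod>i\<in>?T. w - lam i) * (1 / (w - lam k))"
        if "k \<in> ?T" for k
        using that 3 mu_lam assms(1) by (subst (2) prod.remove[of _ k]) auto
      then have "w * (\<Sum>k\<in>?T. x k * (\<Prod>i\<in>?T - {k}. w - lam i))
          = (\<Sum>k\<in>?T. (\<Prod>i\<in>?T. w - lam i) * (x k * (w / (w - lam k))))"
        unfolding sum_distrib_left by (intro sum.cong) simp_all
      then have "poly p w = (\<Prod>k\<in>?T. w - lam k)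
          * (c - (\<Sum>k\<in>?T. x k * (w / (w - lam k))))"
        unfolding poly_p right_diff_distrib sum_distrib_left[symmetric] by simp
      also have "\<dots> = 0" using zeros 3 by simp
      also have "\<dots> = poly q w"
        using 3 assms(1) by (auto simp: poly_q intro!: prod_zero)
      finally show ?thesis .
    qed
  qed (use deg_p deg_q card_A in auto)
  then show ?thesis using poly_p poly_q by simp
qed

text \<open>Follows by dividing the polynomial identity by the product of all
  \<open>z - lam k\<close>. Each factor
  \<open>lam j / \<mu> j * ((z - \<mu> j) / (z - lam j))\<close> equals 1 at \<open>z = 0\<close>;
  the product multiplying \<open>x K\<close> on the right compensates these factors at the pole
  \<open>lam K\<close>.\<close>

lemma interpolation_rational:
  fixes lam \<mu> x :: "'a \<Rightarrow> 'b::field"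
  assumes "finite S" and "K \<notin> S"
    and "\<And>j k. j \<in> insert K S \<Longrightarrow> k \<in> insert K S \<Longrightarrow> \<mu> j \<noteq> lam k"
    and "\<And>k. k \<in> insert K S \<Longrightarrow> lam k \<noteq> 0"
    and "\<And>j. j \<in> insert K S \<Longrightarrow> \<mu> j \<noteq> 0"
    and "inj_on \<mu> S"
    and "\<And>j. j \<in> S \<Longrightarrow> c - (\<Sum>k\<in>insert K S. x k * (\<mu> j / (\<mu> j - lam k))) = 0"
    and z: "\<And>k. k \<in> insert K S \<Longrightarrow> z \<noteq> lam k"
  shows "c - (\<Sum>k\<in>insert K S. x k * (z / (z - lam k)))
       = (\<Prod>j\<in>S. lam j / \<mu> j * ((z - \<mu> j) / (z - lam j)))
           * (c - x K * (\<Prod>j\<in>S. \<mu> j / lam j * ((lam K - lam j) / (lam K - \<mu> j)))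
                 * (z / (z - lam K)))"
proof -
  let ?T = "insert K S" and ?Q = "\<Prod>j\<in>S. z - lam j"
  let ?\<rho> = "\<Prod>j\<in>S. \<mu> j / lam j * ((lam K - lam j) / (lam K - \<mu> j))"
  have QT: "(\<Prod>k\<in>?T. z - lam k) = (z - lam K) * ?Q"
    using assms(1,2) by simp
  have nz: "z - lam K \<noteq> 0" "?Q \<noteq> 0" using z assms(1) by auto
  have del: "(\<Prod>i\<in>?T - {k}. z - lam i) = (z - lam K) * ?Q * (1 / (z - lam k))"
    if "k \<in> ?T" for k
    using that z assms(1) unfolding QT[symmetric] by (subst (2) prod.remove[of _ k]) auto
  have "(z - lam K) * ?Q * (c - (\<Sum>k\<in>?T. x k * (z / (z - lam k))))
      = c * (\<Prod>k\<in>?T. z - lam k) - z * (\<Sum>k\<in>?T. x k * (\<Prod>i\<in>?T - {k}. z - lam i))"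
  proof -
    have "z * (\<Sum>k\<in>?T. x k * (\<Prod>i\<in>?T - {k}. z - lam i))
        = (\<Sum>k\<in>?T. (z - lam K) * ?Q * (x k * (z / (z - lam k))))"
      unfolding sum_distrib_left by (intro sum.cong) (simp_all add: del)
    then show ?thesis
      unfolding QT right_diff_distrib sum_distrib_left[symmetric] by simp
  qed
  also have "\<dots> = (\<Prod>j\<in>S. lam j / \<mu> j * (z - \<mu> j)) * (c * (z - lam K) - x K * ?\<rho> * z)"
    by (rule interpolation_polynomial) (fact assms)+
  also have "(\<Prod>j\<in>S. lam j / \<mu> j * (z - \<mu> j))
      = ?Q * (\<Prod>j\<in>S. lam j / \<mu> j * ((z - \<mu> j) / (z - lam j)))"
    unfolding prod.distrib[symmetric] using z by (intro prod.cong) auto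
  also have "c * (z - lam K) - x K * ?\<rho> * z
      = (z - lam K) * (c - x K * ?\<rho> * (z / (z - lam K)))"
    using nz(1) by (simp add: right_diff_distrib mult_ac)
  finally show ?thesis using nz by simp
qed

lemma tendsto_ratio_at_infinity:
  fixes a b :: "'a::real_normed_field"
  shows "((\<lambda>z. (z - a) / (z - b)) \<longlongrightarrow> 1) at_infinity"
proof -
  have "((\<lambda>z. 1 + (b - a) / (z - b)) \<longlongrightarrow> 1 + 0) at_infinity"
  proof (intro tendsto_intros tendsto_divide_0[OF tendsto_const])
    show "filterlim (\<lambda>z. z - b) at_infinity at_infinity"
      using tendsto_add_filterlim_at_infinity'[OF filterlim_ident tendsto_const[of "- b"]] by simp
  qed
  moreover have "\<forall>\<^sub>F z in at_infinity. 1 + (b - a) / (z - b) = (z - a) / (z - b)"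
    using eventually_not_equal_at_infinity[of b] by eventually_elim (simp add: field_simps)
  ultimately show ?thesis by (simp add: tendsto_cong)
qed

text \<open>Comparison of both sides of the previous identity as \<open>z\<close> tends to infinity.\<close>

lemma interpolation_at_infinity:
  fixes lam \<mu> x :: "'a \<Rightarrow> 'b::{real_normed_field, perfect_space}"
  assumes "finite S" and "K \<notin> S"
    and "\<And>j k. j \<in> insert K S \<Longrightarrow> k \<in> insert K S \<Longrightarrow> \<mu> j \<noteq> lam k"
    and "\<And>k. k \<in> insert K S \<Longrightarrow> lam k \<noteq> 0"
    and "\<And>j. j \<in> insert K S \<Longrightarrow> \<mu> j \<noteq> 0"
    and "inj_on \<mu> S"
    and "\<And>j. j \<in> S \<Longrightarrow> c - (\<Sum>k\<in>insert K S. x k * (\<mu> j / (\<mu> j - lam k))) = 0"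
  shows "c - (\<Sum>k\<in>insert K S. x k)
       = (\<Prod>j\<in>S. lam j / \<mu> j)
           * (c - x K * (\<Prod>j\<in>S. \<mu> j / lam j * ((lam K - lam j) / (lam K - \<mu> j))))"
proof -
  let ?\<rho> = "\<Prod>j\<in>S. \<mu> j / lam j * ((lam K - lam j) / (lam K - \<mu> j))"
  let ?f = "\<lambda>z. c - (\<Sum>k\<in>insert K S. x k * (z / (z - lam k)))"
  let ?g = "\<lambda>z. (\<Prod>j\<in>S. lam j / \<mu> j * ((z - \<mu> j) / (z - lam j)))
      * (c - x K * ?\<rho> * (z / (z - lam K)))"
  note ratio = tendsto_ratio_at_infinity tendsto_ratio_at_infinity[of 0, simplified]
  have f: "(?f \<longlongrightarrow> c - (\<Sum>k\<in>insert K S. x k * 1)) at_infinity"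
    by (intro tendsto_intros ratio)
  have g: "(?g \<longlongrightarrow> (\<Prod>j\<in>S. lam j / \<mu> j * 1) * (c - x K * ?\<rho> * 1)) at_infinity"
    by (intro tendsto_intros ratio)
  have "\<forall>\<^sub>F z in at_infinity. \<forall>k\<in>insert K S. z \<noteq> lam k"
    using assms(1) by (intro eventually_ball_finite ballI eventually_not_equal_at_infinity) auto
  then have "\<forall>\<^sub>F z in at_infinity. ?f z = ?g z"
    by eventually_elim (intro interpolation_rational assms; blast)
  with g have "(?f \<longlongrightarrow> (\<Prod>j\<in>S. lam j / \<mu> j * 1) * (c - x K * ?\<rho> * 1)) at_infinity"
    by (simp only: tendsto_cong)
  from tendsto_unique[OF trivial_limit_at_infinity f this] show ?thesis by simp
qed

text \<open>With \<open>c = 0\<close> and \<open>x K = 0\<close> the right side of the polynomial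
  identity vanishes. At \<open>z = lam m\<close> only the summand \<open>k = m\<close> is left, and
  distinctness of the \<open>lam k\<close> makes its coefficient nonzero.\<close>

lemma interpolation_kernel:
  fixes lam \<mu> x :: "'a \<Rightarrow> 'b::field"
  assumes "finite S" and "K \<notin> S"
    and "\<And>j k. j \<in> insert K S \<Longrightarrow> k \<in> insert K S \<Longrightarrow> \<mu> j \<noteq> lam k"
    and "\<And>k. k \<in> insert K S \<Longrightarrow> lam k \<noteq> 0"
    and "\<And>j. j \<in> insert K S \<Longrightarrow> \<mu> j \<noteq> 0"
    and "inj_on \<mu> S"
    and "\<And>j. j \<in> S \<Longrightarrow> (\<Sum>k\<in>insert K S. x k * (\<mu> j / (\<mu> j - lam k))) = 0"
    and "x K = 0" and inj: "inj_on lam (insert K S)" and m: "m \<in> S"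
  shows "x m = 0"
proof -
  let ?T = "insert K S"
  have "0 * (\<Prod>k\<in>?T. lam m - lam k)
           - lam m * (\<Sum>k\<in>?T. x k * (\<Prod>i\<in>?T - {k}. lam m - lam i))
       = (\<Prod>j\<in>S. lam j / \<mu> j * (lam m - \<mu> j))
           * (0 * (lam m - lam K)
              - x K * (\<Prod>j\<in>S. \<mu> j / lam j * ((lam K - lam j) / (lam K - \<mu> j))) * lam m)"
    using assms by (intro interpolation_polynomial) simp_all
  then have "(\<Sum>k\<in>?T. x k * (\<Prod>i\<in>?T - {k}. lam m - lam i)) = 0"
    using assms(4,8) m by simp
  also have "(\<Sum>k\<in>?T. x k * (\<Prod>i\<in>?T - {k}. lam m - lam i))
      = (\<Sum>k\<in>?T. if k = m then x m * (\<Prod>i\<in>?T - {m}. lam m - lam i) else 0)"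
    using m assms(1) by (intro sum.cong) (auto intro!: prod_zero)
  also have "\<dots> = x m * (\<Prod>i\<in>?T - {m}. lam m - lam i)"
    using m assms(1) by (subst sum.delta) auto
  finally have "x m * (\<Prod>i\<in>?T - {m}. lam m - lam i) = 0" .
  moreover have "(\<Prod>i\<in>?T - {m}. lam m - lam i) \<noteq> 0"
    using m assms(1) inj by (auto simp: inj_on_def)
  ultimately show ?thesis by simp
qed

subsection \<open>Gram matrices and quasideterminants\<close>

text \<open>The general matrix \<open>V\<close> in place of \<open>theta_mat a L\<close> makes room
  for the limiting matrix, whose zero entries no exponential with nonzero amplitude can
  produce.\<close>

definition gram ::
  "('n::finite \<Rightarrow> complex) \<Rightarrow> ('n \<Rightarrow> complex) \<Rightarrow> complex ^ 'n ^ 2 \<Rightarrow> complex ^ 'n ^ 'n" where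
  "gram lam \<mu> V = transpose (Xi_mat \<mu>) ** Omega_mat lam \<mu> V"

definition dressing ::
  "('n::finite \<Rightarrow> complex) \<Rightarrow> ('n \<Rightarrow> complex) \<Rightarrow> complex ^ 'n ^ 2 \<Rightarrow> complex ^ 2 ^ 2" where
  "dressing lam \<mu> V = quasidet (gram lam \<mu> V) (ctranspose V) V (mat 1)"

lemma gram_nth:
  "gram lam \<mu> V $ j $ k = \<mu> j / (\<mu> j - lam k) * (\<Sum>d\<in>UNIV. cnj (V $ d $ j) * V $ d $ k)"
proof -
  have "gram lam \<mu> V $ j $ k
      = (\<Sum>i\<in>UNIV. if i = j then \<mu> j * (Omega_mat lam \<mu> V $ j $ k) else 0)"
    unfolding gram_def matrix_matrix_mult_def transpose_def Xi_mat_def vec_lambda_beta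
    by (intro sum.cong) auto
  then show ?thesis
    by (simp add: Omega_mat_def ctranspose_def matrix_matrix_mult_def)
qed

text \<open>Row \<open>j\<close> of the linear system, with the two sums exchanged, is the
  orthogonality of column \<open>j\<close> of \<open>V\<close> to a rational vector function
  evaluated at \<open>\<mu> j\<close>. This form is what the interpolation lemmas can use.\<close>

lemma gram_mult_eq_iff:
  "gram lam \<mu> V *v X = ctranspose V *v b \<longleftrightarrow>
    (\<forall>j. (\<Sum>d\<in>UNIV. cnj (V $ d $ j)
      * (b $ d - (\<Sum>k\<in>UNIV. V $ d $ k * X $ k * (\<mu> j / (\<mu> j - lam k))))) = 0)"
proof -
  have "(gram lam \<mu> V *v X) $ j
      = (\<Sum>d\<in>UNIV. cnj (V $ d $ j) * (\<Sum>k\<in>UNIV. V $ d $ k * X $ k * (\<mu> j / (\<mu> j - lam k))))" for j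
  proof -
    have "(gram lam \<mu> V *v X) $ j = (\<Sum>k\<in>UNIV. \<Sum>d\<in>UNIV.
        cnj (V $ d $ j) * (V $ d $ k * X $ k * (\<mu> j / (\<mu> j - lam k))))"
      unfolding matrix_vector_mult_def gram_nth
      by (simp add: sum_distrib_left sum_distrib_right mult_ac)
    then show ?thesis
      by (subst (asm) sum.swap) (simp add: sum_distrib_left)
  qed
  moreover have "(ctranspose V *v b) $ j = (\<Sum>d\<in>UNIV. cnj (V $ d $ j) * b $ d)" for j
    by (simp add: matrix_vector_mult_def ctranspose_def)
  ultimately show ?thesis
    by (auto simp: vec_eq_iff right_diff_distrib sum_subtractf)
qed

lemma matrix_inv_mult:
  fixes A :: "'a::field ^ 'n ^ 'n"
  assumes "invertible A"
  shows "matrix_inv A ** A = mat 1" and "A ** matrix_inv A = mat 1"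
  using assms unfolding invertible_def matrix_inv_def by (metis (mono_tags, lifting) someI_ex)+

lemma invertible_iff_kernel:
  fixes A :: "'a::field ^ 'n ^ 'n"
  shows "invertible A \<longleftrightarrow> (\<forall>x. A *v x = 0 \<longrightarrow> x = 0)"
  by (simp add: invertible_left_inverse matrix_left_invertible_ker)

lemma dressing_mult_vector:
  assumes "invertible (gram lam \<mu> V)" and "gram lam \<mu> V *v X = ctranspose V *v b"
  shows "dressing lam \<mu> V *v b = b - V *v X"
proof -
  have "X = matrix_inv (gram lam \<mu> V) *v (ctranspose V *v b)"
    unfolding assms(2)[symmetric]
    by (simp add: matrix_vector_mul_assoc matrix_inv_mult[OF assms(1)])
  then show ?thesis
    by (simp add: dressing_def quasidet_def matrix_vector_mult_diff_rdistrib
        flip: matrix_vector_mul_assoc)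
qed

lemma gram_solvable:
  assumes "invertible (gram lam \<mu> V)"
  obtains X where "gram lam \<mu> V *v X = ctranspose V *v b"
proof
  show "gram lam \<mu> V *v (matrix_inv (gram lam \<mu> V) *v (ctranspose V *v b)) = ctranspose V *v b"
    by (simp add: matrix_vector_mul_assoc matrix_mul_assoc matrix_inv_mult[OF assms])
qed

text \<open>Scaling column \<open>k\<close> by \<open>d k\<close> multiplies entry
  \<open>(j, k)\<close> of the Gram matrix by \<open>cnj (d j) * d k\<close>, and these factors
  cancel in the quasideterminant. The proof carries solutions of one linear system over to the other
  instead of manipulating inverses.\<close>

lemma gram_rescale:
  fixes V W :: "complex ^ 'n::finite ^ 2"
  assumes d_nz: "\<And>k. d k \<noteq> 0" and W: "\<And>i k. W $ i $ k = V $ i $ k * d k"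
    and inv: "invertible (gram lam \<mu> W)"
  shows "invertible (gram lam \<mu> V)" and "dressing lam \<mu> V = dressing lam \<mu> W"
proof -
  have gram_eq: "gram lam \<mu> V *v (\<chi> k. d k * X $ k) = ctranspose V *v b"
    if "gram lam \<mu> W *v X = ctranspose W *v b" for X b
    unfolding gram_mult_eq_iff
  proof
    fix j
    let ?t = "\<lambda>i. b $ i - (\<Sum>k\<in>UNIV. V $ i $ k * (d k * X $ k) * (\<mu> j / (\<mu> j - lam k)))"
    \<comment> \<open>Equation \<open>j\<close> of the rescaled system carries the common factor
      \<open>cnj (d j)\<close>, which is nonzero and can be cancelled.\<close>
    have "cnj (d j) * (\<Sum>i\<in>UNIV. cnj (V $ i $ j) * ?t i) = 0"
      using that unfolding gram_mult_eq_iff W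
      by (auto simp: sum_distrib_left mult_ac dest!: spec[of _ j])
    then show "(\<Sum>i\<in>UNIV. cnj (V $ i $ j) * (b $ i - (\<Sum>k\<in>UNIV. V $ i $ k
        * (\<chi> k. d k * X $ k) $ k * (\<mu> j / (\<mu> j - lam k))))) = 0"
      using d_nz by simp
  qed
  have gram_eq': "gram lam \<mu> W *v (\<chi> k. X $ k / d k) = ctranspose W *v b"
    if "gram lam \<mu> V *v X = ctranspose V *v b" for X b
    unfolding gram_mult_eq_iff
  proof
    fix j
    let ?t = "\<lambda>i. b $ i - (\<Sum>k\<in>UNIV. V $ i $ k * X $ k * (\<mu> j / (\<mu> j - lam k)))"
    have "cnj (d j) * (\<Sum>i\<in>UNIV. cnj (V $ i $ j) * ?t i) = 0"
      using that unfolding gram_mult_eq_iff by simp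
    then show "(\<Sum>i\<in>UNIV. cnj (W $ i $ j) * (b $ i - (\<Sum>k\<in>UNIV. W $ i $ k
        * (\<chi> k. X $ k / d k) $ k * (\<mu> j / (\<mu> j - lam k))))) = 0"
      using d_nz by (simp add: W sum_distrib_left mult_ac)
  qed
  show invV: "invertible (gram lam \<mu> V)"
    unfolding invertible_iff_kernel
  proof safe
    fix X assume "gram lam \<mu> V *v X = 0"
    then have "gram lam \<mu> W *v (\<chi> k. X $ k / d k) = 0"
      using gram_eq'[of X 0] by simp
    then have "(\<chi> k. X $ k / d k) = 0"
      using inv unfolding invertible_iff_kernel by blast
    then show "X = 0" using d_nz by (simp add: vec_eq_iff)
  qed
  show "dressing lam \<mu> V = dressing lam \<mu> W"
    unfolding matrix_eq
  proof
    fix b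
    obtain X where X: "gram lam \<mu> W *v X = ctranspose W *v b"
      using gram_solvable[OF inv] .
    have "V *v (\<chi> k. d k * X $ k) = W *v X"
      by (simp add: matrix_vector_mult_def W mult_ac)
    then show "dressing lam \<mu> V *v b = dressing lam \<mu> W *v b"
      using dressing_mult_vector[OF invV gram_eq[OF X]] dressing_mult_vector[OF inv X] by simp
  qed
qed

section \<open>Continuity of the matrix inverse and of the dressing\<close>

lemma tendsto_det:
  fixes A :: "'b \<Rightarrow> 'a::real_normed_field ^ 'n ^ 'n"
  assumes "(A \<longlongrightarrow> A0) F"
  shows "((\<lambda>x. det (A x)) \<longlongrightarrow> det A0) F"
  unfolding det_def by (intro tendsto_intros assms)

text \<open>Column \<open>j\<close> of the inverse solves a linear system with right side
  \<open>axis j 1\<close>, so Cramer's rule writes each entry as a quotient of determinants. These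
  are continuous, and the denominator stays away from zero near an invertible limit.\<close>

lemma tendsto_matrix_inv:
  fixes A :: "'b \<Rightarrow> 'a::real_normed_field ^ 'n ^ 'n"
  assumes lim: "(A \<longlongrightarrow> A0) F" and "invertible A0"
  shows "((\<lambda>x. matrix_inv (A x)) \<longlongrightarrow> matrix_inv A0) F"
    and "\<forall>\<^sub>F x in F. invertible (A x)"
proof -
  let ?cof = "\<lambda>A i j. det (\<chi> r c. if c = i then axis j 1 $ r else A $ r $ c) / det A"
  have det0: "det A0 \<noteq> 0" using assms(2) by (simp add: invertible_det_nz)
  have inv_nth: "matrix_inv B $ i $ j = ?cof B i j" if "det B \<noteq> 0" for B :: "'a ^ 'n ^ 'n" and i j
  proof -
    have "invertible B" using that by (simp add: invertible_det_nz)
    then have "B *v (matrix_inv B *v axis j 1) = axis j 1"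
      by (simp add: matrix_vector_mul_assoc matrix_inv_mult)
    then have "(matrix_inv B *v axis j 1) $ i = ?cof B i j"
      unfolding cramer[OF that] by simp
    then show ?thesis by (simp add: matrix_vector_mult_def axis_def if_distrib cong: if_cong)
  qed
  have ev: "\<forall>\<^sub>F x in F. det (A x) \<noteq> 0"
    using tendsto_imp_eventually_ne[OF tendsto_det[OF lim] det0] .
  then show "\<forall>\<^sub>F x in F. invertible (A x)" by (simp add: invertible_det_nz)
  show "((\<lambda>x. matrix_inv (A x)) \<longlongrightarrow> matrix_inv A0) F"
  proof (intro vec_tendstoI)
    fix i j
    have entry: "((\<lambda>x. (if c = i then axis j 1 $ r else A x $ r $ c))
        \<longlongrightarrow> (if c = i then axis j 1 $ r else A0 $ r $ c)) F" for r c
      by (cases "c = i") (auto intro!: tendsto_intros lim)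
    have "((\<lambda>x. ?cof (A x) i j) \<longlongrightarrow> ?cof A0 i j) F"
      by (intro tendsto_divide tendsto_det tendsto_vec_lambda entry lim det0)
    \<comment> \<open>Only an eventual equality is available: \<open>matrix_inv\<close> is
      unspecified at singular matrices.\<close>
    moreover have "\<forall>\<^sub>F x in F. ?cof (A x) i j = matrix_inv (A x) $ i $ j"
      using ev by eventually_elim (simp add: inv_nth)
    ultimately show "((\<lambda>x. matrix_inv (A x) $ i $ j) \<longlongrightarrow> matrix_inv A0 $ i $ j) F"
      by (simp add: inv_nth[OF det0] tendsto_cong)
  qed
qed

lemma tendsto_matrix_mult:
  fixes A :: "'b \<Rightarrow> 'a::real_normed_field ^ 'n ^ 'm" and B :: "'b \<Rightarrow> 'a ^ 'k ^ 'n"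
  assumes "(A \<longlongrightarrow> A0) F" and "(B \<longlongrightarrow> B0) F"
  shows "((\<lambda>x. A x ** B x) \<longlongrightarrow> A0 ** B0) F"
  unfolding matrix_matrix_mult_def by (intro tendsto_intros assms)

lemma tendsto_dressing:
  assumes V: "(V \<longlongrightarrow> V0) F" and inv: "invertible (gram lam \<mu> V0)"
  shows "((\<lambda>x. dressing lam \<mu> (V x)) \<longlongrightarrow> dressing lam \<mu> V0) F"
    and "\<forall>\<^sub>F x in F. invertible (gram lam \<mu> (V x))"
proof -
  have gram: "((\<lambda>x. gram lam \<mu> (V x)) \<longlongrightarrow> gram lam \<mu> V0) F"
    by (intro vec_tendstoI, unfold gram_nth)
      (intro tendsto_mult[OF tendsto_const] tendsto_intros V)
  then show "\<forall>\<^sub>F x in F. invertible (gram lam \<mu> (V x))"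
    using inv by (rule tendsto_matrix_inv)
  have "((\<lambda>x. ctranspose (V x)) \<longlongrightarrow> ctranspose V0) F"
    unfolding ctranspose_def by (intro tendsto_intros V)
  then show "((\<lambda>x. dressing lam \<mu> (V x)) \<longlongrightarrow> dressing lam \<mu> V0) F"
    unfolding dressing_def quasidet_def
    by (intro tendsto_diff tendsto_const tendsto_matrix_mult tendsto_matrix_inv[OF gram inv] V)
qed

subsection \<open>The limiting one-soliton configuration\<close>

text \<open>In the limit the rescaled column of \<open>\<theta>\<close> belonging to a soliton \<open>j \<noteq> K\<close> is the unit
  vector \<open>side j\<close>, while the column of the soliton \<open>K\<close> is \<open>E\<close>.\<close>

locale soliton_limit =
  fixes lam \<mu> :: "'n::finite \<Rightarrow> complex" and K :: 'n and side :: "'n \<Rightarrow> 2" and E :: "complex ^ 2"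
  assumes inj_lam: "inj lam" and inj_mu: "inj \<mu>"
    and mu_lam: "\<And>j k. \<mu> j \<noteq> lam k"
    and lam_nz: "\<And>j. lam j \<noteq> 0" and mu_nz: "\<And>j. \<mu> j \<noteq> 0"
begin

definition V :: "complex ^ 'n ^ 2" where
  "V = (\<chi> d k. if k = K then E $ d else if side k = d then 1 else 0)"

definition S :: "2 \<Rightarrow> 'n set" where
  "S d = {k. k \<noteq> K \<and> side k = d}"

text \<open>\<open>C\<close>, \<open>D\<close> and \<open>1 / \<rho>\<close> are the values of the diagonal factor
  \<open>\<Prod>\<^sub>j (1 - \<zeta> / \<mu>\<^sub>j) / (1 - \<zeta> / \<lambda>\<^sub>j)\<close> at \<open>\<zeta> = \<infinity>\<close>, \<open>\<mu>\<^sub>K\<close> and \<open>\<lambda>\<^sub>K\<close>.\<close>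

definition C :: "2 \<Rightarrow> complex" where
  "C d = (\<Prod>j\<in>S d. lam j / \<mu> j)"

definition D :: "2 \<Rightarrow> complex" where
  "D d = (\<Prod>j\<in>S d. lam j / \<mu> j * ((\<mu> K - \<mu> j) / (\<mu> K - lam j)))"

definition \<rho> :: "2 \<Rightarrow> complex" where
  "\<rho> d = (\<Prod>j\<in>S d. \<mu> j / lam j * ((lam K - lam j) / (lam K - \<mu> j)))"

text \<open>Up to the factor \<open>gamma_coef lam \<mu> K K\<close>, this is the coefficient of the
  unknown \<open>X $ K\<close> in \<open>amplitude_equation\<close>. \<open>J_denom_eq\<close>
  relates it to the denominator of the limit.\<close>

definition W :: complex where
  "W = (\<Sum>d\<in>UNIV. cnj (E $ d) * D d * E $ d * \<rho> d)"

text \<open>Row \<open>d\<close> of \<open>V\<close> is supported on \<open>S d\<close> and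
  \<open>K\<close>. Hence the two components are separate interpolation problems, coupled only
  through \<open>X $ K\<close>.\<close>

lemma sum_V: "(\<Sum>k\<in>UNIV. V $ d $ k * f k) = (\<Sum>k\<in>insert K (S d). V $ d $ k * f k)"
  by (rule sum.mono_neutral_right) (auto simp: V_def S_def)

lemma side_facts:
  "finite (S d)" "K \<notin> S d" "inj_on \<mu> (S d)" "inj_on lam (insert K (S d))"
  using inj_on_subset[OF inj_mu subset_UNIV] inj_on_subset[OF inj_lam subset_UNIV]
  by (auto simp: S_def)

text \<open>For \<open>j\<close> in \<open>S d\<close> column \<open>j\<close> of \<open>V\<close>
  is the unit vector \<open>d\<close>, so orthogonality to it is a zero of component
  \<open>d\<close> alone.\<close>

lemma row_zero:
  assumes "gram lam \<mu> V *v X = ctranspose V *v b" and "j \<in> S d"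
  shows "b $ d - (\<Sum>k\<in>insert K (S d). V $ d $ k * X $ k * (\<mu> j / (\<mu> j - lam k))) = 0"
proof -
  let ?t = "\<lambda>e. b $ e - (\<Sum>k\<in>UNIV. V $ e $ k * X $ k * (\<mu> j / (\<mu> j - lam k)))"
  have "0 = (\<Sum>e\<in>UNIV. cnj (V $ e $ j) * ?t e)"
    using assms(1)[unfolded gram_mult_eq_iff, rule_format, of j] by (rule sym)
  also have "\<dots> = (\<Sum>e\<in>UNIV. if e = d then ?t d else 0)"
    using assms(2) by (intro sum.cong) (auto simp: V_def S_def)
  also have "\<dots> = ?t d" by simp
  finally show ?thesis by (simp only: sum_V mult.assoc)
qed

text \<open>Interpolation makes each component at \<open>\<mu> K\<close> an affine function of
  \<open>X $ K\<close>, with prefactor \<open>D d\<close>. Orthogonality to \<open>E\<close>, the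
  remaining equation of the system, then becomes one scalar equation.\<close>

lemma amplitude_equation:
  assumes "gram lam \<mu> V *v X = ctranspose V *v b"
  shows "(\<Sum>d\<in>UNIV. cnj (E $ d) * D d * b $ d) = gamma_coef lam \<mu> K K * X $ K * W"
proof -
  have "b $ d - (\<Sum>k\<in>insert K (S d). V $ d $ k * X $ k * (\<mu> K / (\<mu> K - lam k)))
      = D d * (b $ d - V $ d $ K * X $ K * \<rho> d * (\<mu> K / (\<mu> K - lam K)))" for d
    unfolding D_def \<rho>_def
    by (rule interpolation_rational) (rule side_facts mu_lam lam_nz mu_nz row_zero[OF assms] | assumption)+
  then have "b $ d - (\<Sum>k\<in>UNIV. V $ d $ k * X $ k * (\<mu> K / (\<mu> K - lam k)))
      = D d * (b $ d - V $ d $ K * X $ K * \<rho> d * (\<mu> K / (\<mu> K - lam K)))" for d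
    by (simp only: mult.assoc sum_V)
  moreover have "V $ d $ K = E $ d" for d by (simp add: V_def)
  ultimately have "(\<Sum>d\<in>UNIV. cnj (E $ d)
      * (D d * (b $ d - E $ d * X $ K * \<rho> d * (\<mu> K / (\<mu> K - lam K))))) = 0"
    using assms[unfolded gram_mult_eq_iff, rule_format, of K] by simp
  then show ?thesis
    by (simp add: W_def gamma_coef_def sum_distrib_left right_diff_distrib sum_subtractf mult_ac)
qed

lemma dressed_vector:
  assumes "gram lam \<mu> V *v X = ctranspose V *v b"
  shows "(b - V *v X) $ d = C d * (b $ d - E $ d * X $ K * \<rho> d)"
proof -
  have "b $ d - (\<Sum>k\<in>insert K (S d). V $ d $ k * X $ k) = C d * (b $ d - V $ d $ K * X $ K * \<rho> d)"
    unfolding C_def \<rho>_def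
    by (rule interpolation_at_infinity) (rule side_facts mu_lam lam_nz mu_nz row_zero[OF assms] | assumption)+
  then show ?thesis
    by (simp only: matrix_vector_mult_def vector_minus_component vec_lambda_beta sum_V)
      (simp add: V_def)
qed

text \<open>For a kernel vector the scalar equation forces \<open>X $ K = 0\<close>. Each component
  then satisfies the homogeneous interpolation problem, which has only the zero solution.\<close>

lemma invertible_gram:
  assumes "W \<noteq> 0"
  shows "invertible (gram lam \<mu> V)"
  unfolding invertible_iff_kernel
proof safe
  fix X assume "gram lam \<mu> V *v X = 0"
  then have X: "gram lam \<mu> V *v X = ctranspose V *v 0" by simp
  have "gamma_coef lam \<mu> K K \<noteq> 0"
    using mu_lam mu_nz by (simp add: gamma_coef_def)
  then have XK: "X $ K = 0"
    using amplitude_equation[OF X] assms by simp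
  have "X $ m = 0" if "m \<noteq> K" for m
  proof -
    have "m \<in> S (side m)" using that by (simp add: S_def)
    moreover have "(\<Sum>k\<in>insert K (S (side m)). V $ side m $ k * X $ k * (\<mu> j / (\<mu> j - lam k))) = 0"
      if "j \<in> S (side m)" for j
      using row_zero[OF X that] by simp
    moreover have "V $ side m $ K * X $ K = 0" using XK by simp
    ultimately have "V $ side m $ m * X $ m = 0"
      using interpolation_kernel[of "S (side m)" K \<mu> lam "\<lambda>k. V $ side m $ k * X $ k" m,
          OF side_facts(1,2) mu_lam lam_nz mu_nz side_facts(3) _ _ side_facts(4)]
      by blast
    then show ?thesis using that by (simp add: V_def)
  qed
  with XK show "X = 0" by (metis vec_eq_iff zero_index)
qed

text \<open>Column \<open>e\<close> comes from solving with \<open>b = axis e 1\<close>: the scalar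
  equation gives \<open>X $ K\<close> explicitly, and the value at infinity needs no other
  coordinate of \<open>X\<close>.\<close>

lemma dressing_V:
  assumes "W \<noteq> 0"
  shows "dressing lam \<mu> V $ d $ e = C d * ((if d = e then 1 else 0)
      - E $ d * \<rho> d * cnj (E $ e) * D e / (gamma_coef lam \<mu> K K * W))"
proof -
  let ?g = "gamma_coef lam \<mu> K K"
  have g: "?g \<noteq> 0" using mu_lam mu_nz by (simp add: gamma_coef_def)
  let ?b = "axis e 1 :: complex ^ 2"
  obtain X where X: "gram lam \<mu> V *v X = ctranspose V *v ?b"
    using gram_solvable[OF invertible_gram[OF assms]] .
  have "(\<Sum>d\<in>UNIV. cnj (E $ d) * D d * ?b $ d) = cnj (E $ e) * D e"
    by (simp add: axis_def if_distrib cong: if_cong)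
  then have "X $ K = cnj (E $ e) * D e / (?g * W)"
    using amplitude_equation[OF X] g assms by (simp add: field_simps)
  moreover have "dressing lam \<mu> V $ d $ e = (dressing lam \<mu> V *v ?b) $ d"
    by (simp add: matrix_vector_mult_def axis_def if_distrib cong: if_cong)
  moreover have "\<dots> = C d * (?b $ d - E $ d * X $ K * \<rho> d)"
    unfolding dressing_mult_vector[OF invertible_gram[OF assms] X] by (rule dressed_vector[OF X])
  ultimately show ?thesis by (simp add: axis_def mult_ac)
qed

section \<open>Comparison with the closed form of the limit\<close>

definition diff_prod :: "complex \<Rightarrow> ('n \<Rightarrow> complex) \<Rightarrow> 2 \<Rightarrow> complex" where
  "diff_prod z f d = (\<Prod>j\<in>S d. z - f j)"

lemma prod_split: "(\<Prod>j\<in>UNIV - {K}. f j) = (\<Prod>j\<in>S 1. f j) * (\<Prod>j\<in>S 2. f j)"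
proof -
  have "UNIV - {K} = S 1 \<union> S 2" using exhaust_2 by (auto simp: S_def)
  moreover have "S 1 \<inter> S 2 = {}" by (auto simp: S_def)
  ultimately show ?thesis by (simp add: prod.union_disjoint side_facts(1))
qed

lemma nonzero_facts:
  "C d \<noteq> 0" "diff_prod (lam K) \<mu> d \<noteq> 0" "diff_prod (\<mu> K) lam d \<noteq> 0"
  "gamma_coef lam \<mu> K K \<noteq> 0"
  using mu_lam mu_lam[symmetric] lam_nz mu_nz side_facts(1)
  by (auto simp: C_def diff_prod_def gamma_coef_def)

lemma D_eq: "D d = C d * (diff_prod (\<mu> K) \<mu> d / diff_prod (\<mu> K) lam d)"
  by (simp only: D_def C_def diff_prod_def prod.distrib prod_dividef)

lemma \<rho>_eq: "\<rho> d = diff_prod (lam K) lam d / (diff_prod (lam K) \<mu> d * C d)"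
  by (simp add: \<rho>_def C_def diff_prod_def prod.distrib prod_dividef mult.commute)

context
  fixes \<epsilon>p \<epsilon>m :: "'n \<Rightarrow> pm"
  assumes side: "\<And>j. j \<noteq> K \<Longrightarrow> side j = (if \<epsilon>p j = Plus then 1 else 2)"
    and signs: "\<And>j. j \<noteq> K \<Longrightarrow> (\<epsilon>p j, \<epsilon>m j) \<in> {(Plus, Minus), (Minus, Plus)}"
begin

lemma signs_on_S:
  "j \<in> S 1 \<Longrightarrow> \<epsilon>p j = Plus \<and> \<epsilon>m j = Minus" "j \<in> S 2 \<Longrightarrow> \<epsilon>p j = Minus \<and> \<epsilon>m j = Plus"
  using side[of j] signs[of j] by (auto simp: S_def split: if_splits)

lemma shift_prod_eq:
  "shift_prod lam \<mu> K s \<epsilon>p = diff_prod (lambda_pm lam \<mu> s K) lam 1 * diff_prod (lambda_pm lam \<mu> s K) \<mu> 2"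
  "shift_prod lam \<mu> K s \<epsilon>m = diff_prod (lambda_pm lam \<mu> s K) \<mu> 1 * diff_prod (lambda_pm lam \<mu> s K) lam 2"
  unfolding shift_prod_def diff_prod_def prod_split
  by (auto simp: signs_on_S intro!: arg_cong2[of _ _ _ _ times] prod.cong)

text \<open>A coefficient \<open>c_coef\<close> differs from its default 1 only for the sign
  \<open>Plus\<close>, that is on \<open>S 1\<close> for \<open>\<epsilon>p\<close> and on
  \<open>S 2\<close> for \<open>\<epsilon>m\<close>. The constant matrix thus collects the values
  \<open>C d\<close> at infinity.\<close>

lemma C_mat_eq: "C_mat lam \<mu> K \<epsilon>p \<epsilon>m = vector [vector [C 1, 0], vector [0, C 2]]"
proof -
  have "(\<Prod>j\<in>UNIV - {K}. c_coef lam \<mu> j (\<epsilon>p j)) = C 1 * 1"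
    "(\<Prod>j\<in>UNIV - {K}. c_coef lam \<mu> j (\<epsilon>m j)) = 1 * C 2"
    unfolding prod_split C_def
    by (intro arg_cong2[of _ _ _ _ times] prod.cong prod.neutral ballI refl; simp add: signs_on_S)+
  then show ?thesis by (simp add: C_mat_def)
qed

text \<open>The factor \<open>C d\<close> cancels in \<open>D d * \<rho> d\<close>, and the nonzero
  product on the right clears the remaining denominators. So nonvanishing of the denominator amounts
  to \<open>W \<noteq> 0\<close>.\<close>

lemma J_denom_eq:
  "J_denom lam \<mu> K \<epsilon>p \<epsilon>m (E $ 1) (E $ 2) = W * (diff_prod (lam K) \<mu> 1 * diff_prod (\<mu> K) lam 1
      * diff_prod (lam K) \<mu> 2 * diff_prod (\<mu> K) lam 2)"
  unfolding J_denom_def Let_def complex_norm_square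
  using nonzero_facts
  by (simp add: shift_prod_eq W_def sum_2 D_eq \<rho>_eq field_simps)

lemma dressing_V_eq_J_limit:
  assumes W: "W \<noteq> 0"
  shows "dressing lam \<mu> V = J_limit lam \<mu> K \<epsilon>p \<epsilon>m (E $ 1) (E $ 2)"
proof -
  define g where "g = gamma_coef lam \<mu> K K"
  define P where "P = diff_prod (lam K) \<mu> 1 * diff_prod (\<mu> K) lam 1
      * diff_prod (lam K) \<mu> 2 * diff_prod (\<mu> K) lam 2"
  have nz: "g \<noteq> 0" "P \<noteq> 0" using nonzero_facts by (auto simp: g_def P_def)
  have gamma_tilde: "gamma_tilde lam \<mu> K K = g - 1"
    using mu_lam[of K K] by (simp add: gamma_tilde_def g_def gamma_coef_def field_simps)
  define p where "p = shift_prod lam \<mu> K Plus \<epsilon>p"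
  define p' where "p' = shift_prod lam \<mu> K Minus \<epsilon>m"
  define q where "q = shift_prod lam \<mu> K Plus \<epsilon>m"
  define q' where "q' = shift_prod lam \<mu> K Minus \<epsilon>p"
  note shift_defs = p_def p'_def q_def q'_def
  \<comment> \<open>In the off-diagonal entries the row factor \<open>C d\<close> cancels against
    \<open>\<rho> d\<close>, while \<open>D e\<close> supplies the column factor \<open>C e\<close>.
    This is why the constant matrix multiplies from the right.\<close>
  have coeffs: "\<rho> 1 * D 1 = p * p' / P" "\<rho> 2 * D 2 = q * q' / P"
    "C 1 * \<rho> 1 * D 2 = p * q' / P * C 2" "C 2 * \<rho> 2 * D 1 = p' * q / P * C 1"
    using nonzero_facts
    by (simp_all add: shift_defs shift_prod_eq P_def D_eq \<rho>_eq field_simps)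
  have W_eq: "W * P = p * p' * (E $ 1 * cnj (E $ 1)) + q * q' * (E $ 2 * cnj (E $ 2))"
    using J_denom_eq unfolding P_def[symmetric] J_denom_def Let_def complex_norm_square
    by (simp add: shift_defs)
  have limit_nth: "J_limit lam \<mu> K \<epsilon>p \<epsilon>m (E $ 1) (E $ 2) $ 1 $ 1
      = ((g - 1) * p * p' * (E $ 1 * cnj (E $ 1)) + g * q * q' * (E $ 2 * cnj (E $ 2)))
          / (g * (W * P)) * C 1"
    "J_limit lam \<mu> K \<epsilon>p \<epsilon>m (E $ 1) (E $ 2) $ 1 $ 2
      = - p * q' * E $ 1 * cnj (E $ 2) / (g * (W * P)) * C 2"
    "J_limit lam \<mu> K \<epsilon>p \<epsilon>m (E $ 1) (E $ 2) $ 2 $ 1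
      = - p' * q * cnj (E $ 1) * E $ 2 / (g * (W * P)) * C 1"
    "J_limit lam \<mu> K \<epsilon>p \<epsilon>m (E $ 1) (E $ 2) $ 2 $ 2
      = (g * p * p' * (E $ 1 * cnj (E $ 1)) + (g - 1) * q * q' * (E $ 2 * cnj (E $ 2)))
          / (g * (W * P)) * C 2"
    unfolding J_limit_def Let_def C_mat_eq J_denom_eq P_def[symmetric] gamma_tilde g_def[symmetric]
      shift_defs[symmetric] complex_norm_square matrix_matrix_mult_def map_matrix_def
    by (simp_all add: sum_2)
  have diagonal: "c * (1 - e * r * cnj e * d / (g * W))
      = (g * (W * P) - t * (e * cnj e)) / (g * (W * P)) * c"
    if "r * d = t / P" for c e r d t :: complex
  proof -
    have "e * r * cnj e * d / (g * W) = (r * d) * (e * cnj e) / (g * W)" by simp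
    then show ?thesis using nz W unfolding that by (auto simp: field_simps)
  qed
  have off_diagonal: "c * (0 - e * r * f * d / (g * W)) = - (t * e * f) / (g * (W * P)) * c'"
    if "c * r * d = t / P * c'" for c c' e f r d t :: complex
  proof -
    have "c * (0 - e * r * f * d / (g * W)) = - ((c * r * d) * e * f / (g * W))" by simp
    then show ?thesis unfolding that by (simp add: mult_ac)
  qed
  show ?thesis
    unfolding vec_eq_iff forall_2 limit_nth dressing_V[OF W] g_def[symmetric]
    using diagonal[OF coeffs(1)] diagonal[OF coeffs(2)] off_diagonal[OF coeffs(3)]
      off_diagonal[OF coeffs(4)]
    by (simp add: W_eq) (simp add: algebra_simps)
qed

end

end

subsection \<open>The asymptotic region\<close>

lemma mu_of_nonzero: "l \<noteq> 0 \<Longrightarrow> mu_of R l \<noteq> 0"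
  by (cases R) auto

text \<open>For \<open>E4\<close> and \<open>U22_2\<close> the argument 0 is covered because
  division by zero returns 0, a value taken at no other argument.\<close>

lemma inj_mu_of: "inj (mu_of R)"
  by (cases R) (auto intro!: injI)

text \<open>The two signs are opposite, so the quotient is a constant times an exponential of
  modulus \<open>exp (- (2 * Re (pm_sgn s * L x)))\<close>.\<close>

lemma amp_ratio_tendsto_0:
  assumes "t \<noteq> s" and "filterlim (\<lambda>x. Re (pm_sgn s * L x)) at_top F"
  shows "((\<lambda>x. amp a t (L x) / amp a s (L x)) \<longlongrightarrow> 0) F"
proof -
  have "pm_sgn t = - pm_sgn s"
    using assms(1) by (cases s; cases t) auto
  then have ratio: "amp a t (L x) / amp a s (L x)
      = (a t)\<^sup>2 / (a s)\<^sup>2 * exp (- (2 * (pm_sgn s * L x)))" for x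
    by (simp add: amp_def exp_minus field_simps mult_exp_exp flip: exp_add)
  have "((\<lambda>x. exp (- (2 * Re (pm_sgn s * L x)))) \<longlongrightarrow> 0) F"
    by (intro filterlim_compose[OF exp_at_bot] filterlim_uminus_at_bot[THEN iffD2])
      (use filterlim_tendsto_pos_mult_at_top[OF tendsto_const _ assms(2), of 2] in simp)
  then have "((\<lambda>x. exp (- (2 * (pm_sgn s * L x)))) \<longlongrightarrow> 0) F"
    by (subst tendsto_norm_zero_iff[symmetric]) simp
  then show ?thesis
    unfolding ratio by (rule tendsto_mult_right_zero)
qed

text \<open>The regions shrink as \<open>M\<close> grows, so they form a filter base. This turns the
  uniform convergence of the theorem into a limit along one filter.\<close>

lemma eventually_asymp_filter:
  "eventually P (INF M\<in>{0<..}. principal (asymp_region R L K l \<epsilon>p \<epsilon>m M))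
    \<longleftrightarrow> (\<exists>M>0. \<forall>x\<in>asymp_region R L K l \<epsilon>p \<epsilon>m M. P x)"
proof (subst eventually_INF_base)
  fix M M' :: real assume "M \<in> {0<..}" "M' \<in> {0<..}"
  then show "\<exists>N\<in>{0<..}. principal (asymp_region R L K l \<epsilon>p \<epsilon>m N)
      \<le> inf (principal (asymp_region R L K l \<epsilon>p \<epsilon>m M)) (principal (asymp_region R L K l \<epsilon>p \<epsilon>m M'))"
    by (intro bexI[of _ "max M M'"]) (auto simp: asymp_region_def)
qed (auto simp: eventually_principal)

theorem theorem5p5:
  fixes R :: real_space
    and K :: "'n::finite"
    and a :: "'n \<Rightarrow> pm \<Rightarrow> complex"
    and \<alpha> \<beta> lam \<mu> :: "'n \<Rightarrow> complex"
    and L :: "'n \<Rightarrow> complex ^ 4 \<Rightarrow> complex"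
    and l\<^sub>K :: complex
    and \<epsilon>p \<epsilon>m :: "'n \<Rightarrow> pm"
  assumes mu: "\<And>j. \<mu> j = mu_of R (lam j)"
    and M31_constraint: "R = M31 \<Longrightarrow> (\<forall>j. \<alpha> j = lam j * \<beta> j)"
    and L: "\<And>j. L j = phase (lam j) (\<alpha> j) (\<beta> j)"
    and lambda_nz: "\<And>j. lam j \<noteq> 0"
    and a_nz: "\<And>j s. a j s \<noteq> 0"
    and lambda_distinct: "inj lam"
    and mu_lambda: "\<And>j k. \<mu> j \<noteq> lam k"
    and signs: "\<And>j. j \<noteq> K \<Longrightarrow> (\<epsilon>p j, \<epsilon>m j) \<in> {(Plus, Minus), (Minus, Plus)}"
    and denom_nz: "J_denom lam \<mu> K \<epsilon>p \<epsilon>m (amp (a K) Plus l\<^sub>K) (amp (a K) Minus l\<^sub>K) \<noteq> 0"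
  shows "\<forall>\<eta>>0. \<exists>M>0. \<forall>x \<in> asymp_region R L K l\<^sub>K \<epsilon>p \<epsilon>m M.
           invertible (XiOmega lam \<mu> a (\<lambda>j. L j x)) \<and>
           dist (J_ansatz lam \<mu> a (\<lambda>j. L j x))
             (J_limit lam \<mu> K \<epsilon>p \<epsilon>m (amp (a K) Plus l\<^sub>K) (amp (a K) Minus l\<^sub>K)) < \<eta>"
proof -
  \<comment> \<open>Row 1 of the matrix of exponentials carries the sign \<open>Plus\<close>, so the
    row of the dominant exponential is read off from \<open>\<epsilon>p\<close>.\<close>
  define side :: "'n \<Rightarrow> 2" where "side k = (if \<epsilon>p k = Plus then 1 else 2)" for k
  define sg :: "2 \<Rightarrow> pm" where "sg i = (if i = 1 then Plus else Minus)" for i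
  define E :: "complex ^ 2" where "E = (\<chi> i. amp (a K) (sg i) l\<^sub>K)"
  interpret soliton_limit lam \<mu> K side E
  proof
    show "inj \<mu>"
      using inj_compose[OF inj_mu_of lambda_distinct, of R] by (simp add: comp_def mu[abs_def])
    show "\<mu> j \<noteq> 0" for j
      using mu_of_nonzero lambda_nz by (simp add: mu)
  qed (use lambda_distinct mu_lambda lambda_nz in auto)
  have E_nth: "E $ 1 = amp (a K) Plus l\<^sub>K" "E $ 2 = amp (a K) Minus l\<^sub>K"
    by (simp_all add: E_def sg_def)
  have W_nz: "W \<noteq> 0"
    using denom_nz J_denom_eq[of \<epsilon>p \<epsilon>m] signs by (auto simp: side_def E_nth)
  have limit: "dressing lam \<mu> V
      = J_limit lam \<mu> K \<epsilon>p \<epsilon>m (amp (a K) Plus l\<^sub>K) (amp (a K) Minus l\<^sub>K)"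
    using dressing_V_eq_J_limit[of \<epsilon>p \<epsilon>m] signs W_nz by (simp add: side_def E_nth)

  define F where "F = (INF M\<in>{0<..}. principal (asymp_region R L K l\<^sub>K \<epsilon>p \<epsilon>m M))"
  note eventually_F = eventually_asymp_filter[of _ R L K l\<^sub>K \<epsilon>p \<epsilon>m, folded F_def]
  define \<theta> where "\<theta> x = theta_mat a (\<lambda>j. L j x)" for x
  \<comment> \<open>Column \<open>K\<close> is not rescaled, since its phase is constant on the
    region.\<close>
  define s where "s x k = (if k = K then 1 else 1 / amp (a k) (\<epsilon>p k) (L k x))" for x k
  define U :: "complex ^ 4 \<Rightarrow> complex ^ 'n ^ 2" where "U x = (\<chi> i k. \<theta> x $ i $ k * s x k)" for x
  have amp_nz: "amp (a k) t z \<noteq> 0" for k t z using a_nz by (simp add: amp_def)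
  have \<theta>_nth: "\<theta> x $ i $ k = amp (a k) (sg i) (L k x)" for x i k
    by (simp add: \<theta>_def theta_mat_def sg_def)

  have growth: "filterlim (\<lambda>x. Re (pm_sgn (\<epsilon>p k) * L k x)) at_top F" if "k \<noteq> K" for k
    unfolding filterlim_at_top
  proof
    fix Z :: real
    show "\<forall>\<^sub>F x in F. Z \<le> Re (pm_sgn (\<epsilon>p k) * L k x)"
      unfolding eventually_F
      using signs[OF that] that
      \<comment> \<open>The maximum with 1 keeps the region parameter positive.\<close>
      by (intro exI[of _ "max Z 1"]) (fastforce simp: asymp_region_def)
  qed
  have "(U \<longlongrightarrow> V) F"
  proof (intro vec_tendstoI)
    fix i k
    show "((\<lambda>x. U x $ i $ k) \<longlongrightarrow> V $ i $ k) F"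
    proof (cases "k = K")
      case True
      have "V $ i $ K = amp (a K) (sg i) l\<^sub>K" unfolding V_def by (simp add: E_def)
      then have "\<forall>\<^sub>F x in F. U x $ i $ k = V $ i $ k"
        unfolding eventually_F
        by (intro exI[of _ 1]) (auto simp: asymp_region_def U_def \<theta>_nth s_def True)
      then show ?thesis by (rule tendsto_eventually)
    next
      case False
      then have U: "U x $ i $ k = amp (a k) (sg i) (L k x) / amp (a k) (\<epsilon>p k) (L k x)" for x
        by (simp add: U_def \<theta>_nth s_def)
      show ?thesis
      \<comment> \<open>The dominant entry of the rescaled column is identically 1; the other one
        decays.\<close>
      proof (cases "sg i = \<epsilon>p k")
        case True
        then have "side k = i"
          using exhaust_2[of i] by (auto simp: side_def sg_def split: if_splits)
        then show ?thesis using False True amp_nz by (simp add: U V_def)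
      next
        case ne: False
        then have "side k \<noteq> i"
          using signs[OF False] by (auto simp: side_def sg_def split: if_splits)
        then show ?thesis
          using amp_ratio_tendsto_0[OF ne growth[OF False]] False by (simp add: U V_def)
      qed
    qed
  qed
  note lim = tendsto_dressing[OF this invertible_gram[OF W_nz]]
  show ?thesis
  proof (intro allI impI)
    fix \<eta> :: real assume "\<eta> > 0"
    have "\<forall>\<^sub>F x in F. invertible (gram lam \<mu> (U x))
        \<and> dist (dressing lam \<mu> (U x)) (dressing lam \<mu> V) < \<eta>"
      using lim(2) tendstoD[OF lim(1) \<open>\<eta> > 0\<close>] by (rule eventually_conj)
    then have "\<forall>\<^sub>F x in F. invertible (gram lam \<mu> (\<theta> x))
        \<and> dist (dressing lam \<mu> (\<theta> x)) (dressing lam \<mu> V) < \<eta>"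
    proof eventually_elim
      case (elim x)
      have "s x k \<noteq> 0" for k by (simp add: s_def amp_nz)
      moreover have "U x $ i $ k = \<theta> x $ i $ k * s x k" for i k by (simp add: U_def)
      ultimately show ?case
        using gram_rescale[of "s x" "U x" "\<theta> x"] elim by simp
    qed
    then show "\<exists>M>0. \<forall>x \<in> asymp_region R L K l\<^sub>K \<epsilon>p \<epsilon>m M.
           invertible (XiOmega lam \<mu> a (\<lambda>j. L j x)) \<and>
           dist (J_ansatz lam \<mu> a (\<lambda>j. L j x))
             (J_limit lam \<mu> K \<epsilon>p \<epsilon>m (amp (a K) Plus l\<^sub>K) (amp (a K) Minus l\<^sub>K)) < \<eta>"
      unfolding eventually_F limit
      by (simp add: XiOmega_def J_ansatz_def gram_def dressing_def \<theta>_def)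
  qed
qed

end
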